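(* Let $q$ be a prime power. Let $C_i$ be a $(v_i,N_i,d_i;k)_q$ constant dimension code for $i=1,2$, let $d\in 2\mathbb{N}_{\ge 0}$ (i.e., $d$ is a nonnegative even integer), and let $C_r$ be a $(k\times(v_2-k+d/2),N_r,d_r)_q$ linear rank metric code. Then $$\mathcal{C}=\{\tau^{-1}(\tau(U)\mid M) : U\in C_1,\ M\in C_r\}\ \cup\ \{\tau^{-1}(0_{k\times(v_1-k+d/2)}\mid\tau(W)) : W\in C_2\}$$ is a $(v_1+v_2-k+d/2,\ N_1N_r+N_2,\ \min\{d_1,d_2,2d_r,d\};\ k)_q$ constant dimension code.
   Context: For subspaces $U,W$ of $\mathbb{F}_q^v$ the subspace distance is $\mathrm{d}_{\mathrm s}(U,W)=\dim(U)+\dim(W)-2\dim(U\cap W)$. A $(v,N,d;k)_q$ constant dimension code is a set of $N$ subspaces of $\mathbb{F}_q^v$, each of dimension $k\in\{0,1,\ldots,v\}$, with minimum subspace distance $d$. Here a code $\mathcal{C}$ has minimum distance $d$ if $d\le\mathrm{d}_{\mathrm s}(U,W)$ for all $U\neq W$ in $\mathcal{C}$ and equality is attained at least once; if $\#\mathcal{C}=1$, the minimum distance is set to $\infty$. An $(m\times n,N,d_r)_q$ rank metric code is a subset of $\mathbb{F}_q^{m\times n}$ of cardinality $N$ with minimum rank distance $d_r$, where the rank distance of matrices $A,B$ is $\mathrm{rk}(A-B)$ (the minimum rank distance of a one-element code is $\infty$); it is linear if it is an $\mathbb{F}_q$-subspace of $\mathbb{F}_q^{m\times n}$. For a $k$-dimensional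 subspace $U\le\mathbb{F}_q^v$, $\tau(U)\in\mathbb{F}_q^{k\times v}$ is the unique matrix in reduced row echelon form whose row space is $U$; $\tau$ is a bijection from the $k$-dimensional subspaces of $\mathbb{F}_q^v$ to the $k\times v$ matrices of rank $k$ in reduced row echelon form, and $\tau^{-1}(X)$ is the row space of $X$. $A\mid B$ denotes the concatenation of two matrices with the same number of rows, and $0_{m\times n}$ is the $m\times n$ zero matrix.
   Formalization: Minimum distance exactly min{d1,d2,2dr,d} is shown if min{d1,d2,2dr} ≤ d; for 0<d≤2k it is shown to be at least that, as d need not be attained. The cases d=0, and d>2k with C1, C2, Cr all one-element, are left out: the claim fails there. *)

theory Defs
  imports
    "Jordan_Normal_Form.DL_Rank"
    "Jordan_Normal_Form.Gauss_Jordan_Elimination"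
    "HOL-Library.Extended_Nat"
begin

text \<open>
  The field \<open>F_q\<close> is an arbitrary type of sort \<open>{field, finite}\<close>, so \<open>q\<close> is its cardinality.
  \<open>F_q^v\<close> is \<^term>\<open>carrier_vec v\<close>; subspaces of it are sets of vectors.
\<close>

abbreviation is_subspace :: "nat \<Rightarrow> 'a::field vec set \<Rightarrow> bool" where
  "is_subspace v U \<equiv> VectorSpace.subspace class_ring U (module_vec TYPE('a) v)"

definition sdim :: "nat \<Rightarrow> 'a::field vec set \<Rightarrow> nat" where
  "sdim v U = vectorspace.dim class_ring ((module_vec TYPE('a) v)\<lparr>carrier := U\<rparr>)"

text \<open>The subtraction does not truncate when \<open>U\<close> and \<open>W\<close> are subspaces of \<open>F_q^v\<close>.\<close>

definition subspace_dist :: "nat \<Rightarrow> 'a::field vec set \<Rightarrow> 'a vec set \<Rightarrow> nat" where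
  "subspace_dist v U W = sdim v U + sdim v W - 2 * sdim v (U \<inter> W)"

definition rank_dist :: "nat \<Rightarrow> 'a::field mat \<Rightarrow> 'a mat \<Rightarrow> nat" where
  "rank_dist m A B = vec_space.rank m (A - B)"

text \<open>An empty code has no minimum distance; a one-element code has minimum distance \<open>\<infinity>\<close>.\<close>

definition has_min_dist :: "('b \<Rightarrow> 'b \<Rightarrow> nat) \<Rightarrow> 'b set \<Rightarrow> enat \<Rightarrow> bool" where
  "has_min_dist \<delta> C d \<longleftrightarrow>
    (if card C = 1 then d = \<infinity>
     else (\<forall>x\<in>C. \<forall>y\<in>C. x \<noteq> y \<longrightarrow> d \<le> enat (\<delta> x y)) \<and>
          (\<exists>x\<in>C. \<exists>y\<in>C. x \<noteq> y \<and> d = enat (\<delta> x y)))"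

definition constant_dim_code ::
    "nat \<Rightarrow> nat \<Rightarrow> enat \<Rightarrow> nat \<Rightarrow> 'a::{field,finite} vec set set \<Rightarrow> bool" where
  "constant_dim_code v N d k C \<longleftrightarrow>
    k \<le> v \<and> card C = N \<and>
    (\<forall>U\<in>C. is_subspace v U \<and> sdim v U = k) \<and>
    has_min_dist (subspace_dist v) C d"

definition rank_metric_code ::
    "nat \<Rightarrow> nat \<Rightarrow> nat \<Rightarrow> enat \<Rightarrow> 'a::{field,finite} mat set \<Rightarrow> bool" where
  "rank_metric_code m n N d C \<longleftrightarrow>
    C \<subseteq> carrier_mat m n \<and> card C = N \<and> has_min_dist (rank_dist m) C d"

definition linear_rank_metric_code ::
    "nat \<Rightarrow> nat \<Rightarrow> nat \<Rightarrow> enat \<Rightarrow> 'a::{field,finite} mat set \<Rightarrow> bool" where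
  "linear_rank_metric_code m n N d C \<longleftrightarrow>
    rank_metric_code m n N d C \<and>
    VectorSpace.subspace class_ring C (module_mat TYPE('a) m n)"

text \<open>
  \<^const>\<open>row_echelon_form\<close> is the reduced form: pivots are \<open>1\<close> and are the only nonzero
  entries of their columns.
\<close>

definition tau :: "nat \<Rightarrow> 'a::field vec set \<Rightarrow> 'a mat" where
  "tau v U = (THE A. A \<in> carrier_mat (sdim v U) v \<and> row_echelon_form A \<and>
                     vec_space.row_space v A = U)"

definition tau_inv :: "'a::field mat \<Rightarrow> 'a vec set" where
  "tau_inv A = vec_space.row_space (dim_col A) A"

definition hconcat :: "'a::zero mat \<Rightarrow> 'a mat \<Rightarrow> 'a mat" where
  "hconcat A B = four_block_mat A B (0\<^sub>m 0 (dim_col A)) (0\<^sub>m 0 (dim_col B))"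

end

theory Submission
  imports Defs "Berlekamp_Zassenhaus.Berlekamp_Type_Based"
begin

text \<open>
  A subspace of dimension \<open>s\<close> has \<open>q\<^sup>s\<close> elements, so distances between \<open>k\<close>-dimensional subspaces are
  read off from the cardinality of the intersection. The elements of \<open>\<tau>\<^sup>-\<^sup>1(A | B)\<close> are the vectors
  \<open>(x A, x B)\<close>. Two codewords of the first kind with distinct \<open>U\<close> intersect in a set that projects
  injectively into the intersection of the original subspaces; with equal \<open>U\<close> they share the
  vectors with \<open>x (M - M') = 0\<close>, which gives distance \<open>2 rk (M - M')\<close>. Padding by zeros preserves
  distances. A codeword of the first kind meets one of the second kind in vectors that vanish on
  all but \<open>k - d/2\<close> of the first \<open>v\<^sub>1\<close> coordinates, and these coordinates determine the vector, so
  the distance is at least \<open>min {d, 2k}\<close>. Since \<open>0 \<in> C\<^sub>r\<close>, each of \<open>d\<^sub>1, d\<^sub>2, 2 d\<^sub>r\<close> is attained when finite.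
\<close>

section \<open>Subspaces, images and kernels over a finite field, measured by cardinality\<close>

lemma CARD_field_gt_1: "1 < CARD('a::{field,finite})"
proof -
  have "card {0, 1 :: 'a} \<le> CARD('a)" by (rule card_mono) auto
  then show ?thesis by simp
qed

lemma is_subspace_iff:
  "is_subspace v U \<longleftrightarrow> U \<subseteq> carrier_vec v \<and> 0\<^sub>v v \<in> U \<and>
     (\<forall>x\<in>U. \<forall>y\<in>U. x + y \<in> U) \<and> (\<forall>c. \<forall>x\<in>U. c \<cdot>\<^sub>v x \<in> U)"
  for U :: "'a::field vec set"
  using vec_vs[where 'a='a and n=v] vec_module[where 'a='a and n=v]
  unfolding VectorSpace.subspace_def LinearCombinations.submodule_def
  by (auto simp: module_vec_simps class_ring_simps)

lemma is_subspace_Int: "is_subspace v U \<Longrightarrow> is_subspace v W \<Longrightarrow> is_subspace v (U \<inter> W)"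
  unfolding is_subspace_iff by auto

lemma is_subspace_span:
  assumes "S \<subseteq> carrier_vec v"
  shows "is_subspace v (LinearCombinations.module.span class_ring (module_vec TYPE('a::field) v) S)"
proof -
  interpret vec_space "TYPE('a)" v .
  show ?thesis by (rule span_is_subspace) (use assms in auto)
qed

lemma finite_subspace: "is_subspace v U \<Longrightarrow> finite U" for U :: "'a::{field,finite} vec set"
  by (auto simp: is_subspace_iff intro: finite_subset[OF _ finite_carrier_vec])

text \<open>Coordinates with respect to a basis give a bijection from the functions
  \<open>B \<rightarrow>\<^sub>E UNIV\<close> onto \<open>U\<close>, which yields the power of q. A
  finite basis exists because \<open>U\<close> is finite and generates itself.\<close>

lemma subspace_basis:
  fixes U :: "'a::{field,finite} vec set"
  assumes U: "is_subspace v U"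
  obtains B where "finite B" "card B = sdim v U" "B \<subseteq> U"
    "LinearCombinations.module.span class_ring (module_vec TYPE('a) v) B = U"
    "card U = CARD('a) ^ card B"
proof -
  interpret vec_space "TYPE('a)" v .
  interpret U: vectorspace class_ring "V\<lparr>carrier := U\<rparr>"
    using subspace_is_vs[OF U] .
  have sub: "submodule class_ring U V" using U by (simp add: VectorSpace.subspace_def)
  have "U.gen_set U"
    using U.in_own_span[of U] U.span_is_subset2[of U] by auto
  then have "U.fin_dim"
    unfolding U.fin_dim_def using finite_subspace[OF U] by (intro exI[of _ U]) auto
  then obtain B where B: "finite B" "U.basis B"
    using U.finite_basis_exists by auto
  then have BU: "B \<subseteq> U" and span: "U.span B = U" by (auto simp: U.basis_def)
  have 1: "\<exists>!a. a \<in> B \<rightarrow>\<^sub>E (UNIV :: 'a set) \<and> U.lincomb a B = x" if "x \<in> U" for x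
    using U.basis_criterion[of B] B BU that by (auto simp: class_ring_simps)
  have 2: "U.lincomb a B \<in> U" for a
    using U.lincomb_closed[of B a] BU by (auto simp: class_ring_simps)
  have "bij_betw (\<lambda>a. U.lincomb a B) (B \<rightarrow>\<^sub>E (UNIV :: 'a set)) U"
    unfolding bij_betw_def inj_on_def using 1 2 by (auto simp: image_iff) blast+
  then have "card U = CARD('a) ^ card B"
    using B by (auto dest: bij_betw_same_card simp: card_PiE)
  \<comment> \<open>\<open>sdim\<close> refers to \<open>U\<close> as a space of its own; spans
    computed there agree with spans in the ambient space.\<close>
  moreover have "span B = U"
    using span_li_not_depend(1)[OF BU sub] span by simp
  moreover have "card B = sdim v U"
    using U.dim_basis[OF B] by (simp add: sdim_def)
  ultimately show thesis using that B(1) BU by blast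
qed

lemma card_subspace: "is_subspace v U \<Longrightarrow> card U = CARD('a) ^ sdim v U"
  for U :: "'a::{field,finite} vec set"
  by (metis subspace_basis)

text \<open>This form makes the coefficient vector \<open>x\<close> of a row combination explicit;
  intersections of codewords are later described through such coefficients.\<close>

lemma row_space_image:
  fixes A :: "'a::field mat"
  assumes "A \<in> carrier_mat m n"
  shows "vec_space.row_space n A = (\<lambda>x. A\<^sup>T *\<^sub>v x) ` carrier_vec m"
proof -
  interpret vec_space "TYPE('a)" n .
  show ?thesis using row_space_eq[OF assms] assms by auto
qed

lemma is_subspace_row_space:
  assumes "A \<in> carrier_mat m n"
  shows "is_subspace n (vec_space.row_space n A)"
proof -
  interpret vec_space "TYPE('a)" n .
  show ?thesis unfolding row_space_def
    by (rule is_subspace_span) (use assms in \<open>auto simp: rows_def\<close>)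
qed

text \<open>\<open>rank\<close> is the dimension of the column space, which is the image of the
  matrix, so the rank becomes an exponent of q.\<close>

lemma card_mat_image:
  fixes A :: "'a::{field,finite} mat"
  assumes A: "A \<in> carrier_mat m n"
  shows "card ((\<lambda>x. A *\<^sub>v x) ` carrier_vec n) = CARD('a) ^ vec_space.rank m A"
proof -
  interpret vec_space "TYPE('a)" m .
  have cols: "set (cols A) \<subseteq> carrier_vec m" using A by (auto simp: cols_def)
  have "(\<lambda>x. A *\<^sub>v x) ` carrier_vec n = col_space A"
    using col_space_eq[OF A] A by auto
  moreover have "rank A = sdim m (col_space A)"
    by (simp add: rank_def sdim_def col_space_def)
  ultimately show ?thesis
    using card_subspace is_subspace_span[OF cols] by (metis col_space_def)
qed

text \<open>Every nonempty fibre is a translate of the kernel, so the domain splits into equally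
  large fibres, one for each point of the image.\<close>

lemma card_image_mult_card_kernel:
  fixes B :: "'a::{field,finite} mat"
  assumes B: "B \<in> carrier_mat n k"
  shows "card ((\<lambda>x. B *\<^sub>v x) ` carrier_vec k) * card {x \<in> carrier_vec k. B *\<^sub>v x = 0\<^sub>v n}
    = CARD('a) ^ k"
proof -
  let ?K = "{x \<in> carrier_vec k. B *\<^sub>v x = 0\<^sub>v n}"
  let ?I = "(\<lambda>x. B *\<^sub>v x) ` carrier_vec k"
  have fib: "card {x \<in> carrier_vec k. B *\<^sub>v x = y} = card ?K" if "y \<in> ?I" for y
  proof -
    obtain z where z: "z \<in> carrier_vec k" "y = B *\<^sub>v z" using \<open>y \<in> ?I\<close> by auto
    have "bij_betw (\<lambda>x. x + z) ?K {x \<in> carrier_vec k. B *\<^sub>v x = y}"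
    proof (rule bij_betw_byWitness[where f' = "\<lambda>x. x - z"])
      show "\<forall>a\<in>?K. a + z - z = a" 
        and "\<forall>a'\<in>{x \<in> carrier_vec k. B *\<^sub>v x = y}. a' - z + z = a'"
        using z by (auto intro!: eq_vecI)
      show "(\<lambda>x. x + z) ` ?K \<subseteq> {x \<in> carrier_vec k. B *\<^sub>v x = y}"
        using z B by (auto simp: mult_add_distrib_mat_vec[OF B])
      show "(\<lambda>x. x - z) ` {x \<in> carrier_vec k. B *\<^sub>v x = y} \<subseteq> ?K"
        using z B by (auto simp: mult_minus_distrib_mat_vec[OF B])
    qed
    then show ?thesis by (auto dest: bij_betw_same_card)
  qed
  have "card (carrier_vec k :: 'a vec set) = (\<Sum>y\<in>?I. card {x \<in> carrier_vec k. B *\<^sub>v x = y})"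
    using sum.group[of "carrier_vec k" ?I "\<lambda>x. B *\<^sub>v x" "\<lambda>_. 1 :: nat"] by simp
  also have "\<dots> = card ?I * card ?K" using fib by simp
  finally show ?thesis by (simp add: card_carrier_vec)
qed

section \<open>Left kernels\<close>

text \<open>The functional given by a nonzero \<open>u\<close> is onto the field, so its kernel
  contains one q-th of all vectors.\<close>

lemma card_orthogonal:
  fixes u :: "'a::{field,finite} vec"
  assumes u: "u \<in> carrier_vec n" "u \<noteq> 0\<^sub>v n"
  shows "CARD('a) * card {y \<in> carrier_vec n. u \<bullet> y = 0} = CARD('a) ^ n"
proof -
  let ?R = "mat_of_row u"
  have R: "?R \<in> carrier_mat 1 n" using u by auto
  have Ry: "?R *\<^sub>v y = vec 1 (\<lambda>_. u \<bullet> y)" if "y \<in> carrier_vec n" for y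
    using that u by (intro eq_vecI) auto
  obtain i where i: "i < n" "u $ i \<noteq> 0"
    using u by (metis carrier_vecD eq_vecI index_zero_vec)
  have "(\<lambda>y. ?R *\<^sub>v y) ` carrier_vec n = carrier_vec 1"
  proof (intro equalityI subsetI)
    fix w :: "'a vec" assume w: "w \<in> carrier_vec 1"
    \<comment> \<open>Rescaling the unit vector at a nonzero coordinate of \<open>u\<close> reaches
      any prescribed value.\<close>
    let ?y = "(w $ 0 / u $ i) \<cdot>\<^sub>v unit_vec n i"
    have "u \<bullet> ?y = w $ 0" using u i by simp
    then have "?R *\<^sub>v ?y = w" using w by (subst Ry) (auto intro!: eq_vecI)
    then show "w \<in> (\<lambda>y. ?R *\<^sub>v y) ` carrier_vec n" by (intro image_eqI[of _ _ ?y]) auto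
  qed (use R in auto)
  moreover have "{y \<in> carrier_vec n. ?R *\<^sub>v y = 0\<^sub>v 1} = {y \<in> carrier_vec n. u \<bullet> y = 0}"
    by (auto simp: Ry vec_eq_iff)
  ultimately show ?thesis
    using card_image_mult_card_kernel[OF R] by (simp add: card_carrier_vec)
qed

text \<open>Stated additively, so that no truncated subtraction occurs.\<close>

lemma card_orthogonal_pairs:
  fixes B :: "'a::{field,finite} mat"
  assumes B: "B \<in> carrier_mat n k"
  defines "K \<equiv> {x \<in> carrier_vec k. B *\<^sub>v x = 0\<^sub>v n}"
  shows "CARD('a) * card {(x, y). x \<in> carrier_vec k \<and> y \<in> carrier_vec n \<and> (B *\<^sub>v x) \<bullet> y = 0}
      + card K * CARD('a) ^ n
    = CARD('a) ^ (n + k) + CARD('a) * card K * CARD('a) ^ n"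
proof -
  let ?q = "CARD('a)"
  let ?c = "\<lambda>x. ?q * card {y \<in> carrier_vec n. (B *\<^sub>v x) \<bullet> y = 0}"
  have KC: "K \<subseteq> carrier_vec k" by (auto simp: K_def)
  have fin: "finite K" using KC by (rule finite_subset) simp
  have "{(x, y). x \<in> carrier_vec k \<and> y \<in> carrier_vec n \<and> (B *\<^sub>v x) \<bullet> y = 0}
      = (SIGMA x:carrier_vec k. {y \<in> carrier_vec n. (B *\<^sub>v x) \<bullet> y = 0})" by auto
  then have "?q * card {(x, y). x \<in> carrier_vec k \<and> y \<in> carrier_vec n \<and> (B *\<^sub>v x) \<bullet> y = 0}
      = (\<Sum>x\<in>carrier_vec k. ?c x)"
    by (simp add: sum_distrib_left)
  \<comment> \<open>For \<open>x\<close> outside the kernel the admissible \<open>y\<close> form a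
    hyperplane; for \<open>x\<close> in the kernel every \<open>y\<close> is admissible.\<close>
  also have "\<dots> = (\<Sum>x\<in>carrier_vec k - K. ?c x) + (\<Sum>x\<in>K. ?c x)"
    using KC by (intro sum.subset_diff) auto
  also have "(\<Sum>x\<in>carrier_vec k - K. ?c x) = (\<Sum>x\<in>carrier_vec k - K. ?q ^ n)"
    using B by (intro sum.cong refl card_orthogonal) (auto simp: K_def)
  also have "\<dots> = (?q ^ k - card K) * ?q ^ n"
    using KC fin by (simp add: card_Diff_subset card_carrier_vec)
  also have "(\<Sum>x\<in>K. ?c x) = (\<Sum>x\<in>K. ?q * ?q ^ n)"
  proof (intro sum.cong refl)
    fix x assume "x \<in> K"
    then have "{y \<in> carrier_vec n. (B *\<^sub>v x) \<bullet> y = 0} = carrier_vec n" by (auto simp: K_def)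
    then show "?c x = ?q * ?q ^ n" by (simp add: card_carrier_vec)
  qed
  also have "\<dots> = ?q * card K * ?q ^ n" by simp
  finally have 1: "?q * card {(x, y). x \<in> carrier_vec k \<and> y \<in> carrier_vec n \<and> (B *\<^sub>v x) \<bullet> y = 0}
    = (?q ^ k - card K) * ?q ^ n + ?q * card K * ?q ^ n" .
  have "card K \<le> ?q ^ k"
    using card_mono[OF _ KC] by (simp add: card_carrier_vec)
  then have "(?q ^ k - card K) * ?q ^ n + card K * ?q ^ n = ?q ^ (n + k)"
    by (metis add_mult_distrib le_add_diff_inverse2 mult.commute power_add)
  with 1 show ?thesis by simp
qed

text \<open>Counting the pairs \<open>(x, y)\<close> with \<open>x\<^sup>T A y = 0\<close> in both orders relates the left and the right
  kernel of \<open>A\<close>; this replaces the theorem that row rank equals column rank.\<close>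

lemma card_left_kernel:
  fixes A :: "'a::{field,finite} mat"
  assumes A: "A \<in> carrier_mat k n"
  shows "card {x \<in> carrier_vec k. A\<^sup>T *\<^sub>v x = 0\<^sub>v n} * CARD('a) ^ vec_space.rank k A = CARD('a) ^ k"
proof -
  let ?q = "CARD('a)"
  let ?K = "{x \<in> carrier_vec k. A\<^sup>T *\<^sub>v x = 0\<^sub>v n}"
  let ?L = "{y \<in> carrier_vec n. A *\<^sub>v y = 0\<^sub>v k}"
  let ?P = "{(x, y). x \<in> carrier_vec k \<and> y \<in> carrier_vec n \<and> (A\<^sup>T *\<^sub>v x) \<bullet> y = 0}"
  let ?P' = "{(y, x). y \<in> carrier_vec n \<and> x \<in> carrier_vec k \<and> (A *\<^sub>v y) \<bullet> x = 0}"
  have q: "1 < ?q" by (rule CARD_field_gt_1)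
  have "(A\<^sup>T *\<^sub>v x) \<bullet> y = (A *\<^sub>v y) \<bullet> x" if "x \<in> carrier_vec k" "y \<in> carrier_vec n" for x y
    using that A
    by (metis transpose_vec_mult_scalar mult_mat_vec_carrier comm_scalar_prod)
  then have "?P' = prod.swap ` ?P" by auto
  then have "card ?P' = card ?P" by (simp add: card_image)
  then have "card ?K * ?q ^ n + ?q * card ?L * ?q ^ k = card ?L * ?q ^ k + ?q * card ?K * ?q ^ n"
    using card_orthogonal_pairs[of "A\<^sup>T" n k] card_orthogonal_pairs[OF A] A
    by (simp add: add.commute)
  \<comment> \<open>Over the integers the factor q - 1 can be collected on both sides; it is nonzero
    and cancels.\<close>
  then have "int (card ?K * ?q ^ n + ?q * card ?L * ?q ^ k)
      = int (card ?L * ?q ^ k + ?q * card ?K * ?q ^ n)" by presburger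
  then have "(int ?q - 1) * int (card ?L * ?q ^ k) = (int ?q - 1) * int (card ?K * ?q ^ n)"
    by (simp add: algebra_simps)
  then have KL: "card ?L * ?q ^ k = card ?K * ?q ^ n" using q by (simp del: of_nat_mult)
  have L: "?q ^ vec_space.rank k A * card ?L = ?q ^ n"
    using card_image_mult_card_kernel[OF A] card_mat_image[OF A] by simp
  have "?q ^ n * (card ?K * ?q ^ vec_space.rank k A) = ?q ^ vec_space.rank k A * (card ?L * ?q ^ k)"
    by (simp add: KL)
  also have "\<dots> = ?q ^ n * ?q ^ k" by (simp only: L mult.assoc[symmetric])
  finally show ?thesis by simp
qed

section \<open>Uniqueness of the reduced row echelon form\<close>

lemma index_transpose_mult_vec:
  assumes "A \<in> carrier_mat k v" "x \<in> carrier_vec k" "j < v"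
  shows "(A\<^sup>T *\<^sub>v x) $ j = (\<Sum>i<k. A $$ (i, j) * x $ i)"
  using assms by (simp add: scalar_prod_def lessThan_atLeast0)

lemma transpose_mult_unit_vec:
  fixes A :: "'a::semiring_1 mat"
  assumes "A \<in> carrier_mat k v" "i < k"
  shows "A\<^sup>T *\<^sub>v unit_vec k i = row A i"
  using assms by (intro eq_vecI) auto

text \<open>A map from q^k coefficient vectors onto a set of q^k elements is injective. Full row
  rank is used in this form from here on.\<close>

lemma inj_on_row_comb:
  fixes A :: "'a::{field,finite} mat"
  assumes A: "A \<in> carrier_mat k v" and card: "card (vec_space.row_space v A) = CARD('a) ^ k"
  shows "inj_on (\<lambda>x. A\<^sup>T *\<^sub>v x) (carrier_vec k)"
  using card by (intro eq_card_imp_inj_on) (simp_all add: row_space_image[OF A] card_carrier_vec)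

text \<open>Injectivity excludes zero rows, so every row has a genuine pivot. Pivot columns are unit
  vectors, hence the coefficients of a row combination appear at the pivot positions, and its
  leading entry sits at the pivot of the first nonzero coefficient.\<close>

lemma pivot_fun_full_rank:
  fixes A :: "'a::field mat"
  assumes A: "A \<in> carrier_mat k v" and p: "pivot_fun A f v"
    and inj: "inj_on (\<lambda>x. A\<^sup>T *\<^sub>v x) (carrier_vec k)"
  shows "\<And>i. i < k \<Longrightarrow> f i < v"
    and "\<And>i j. i < j \<Longrightarrow> j < k \<Longrightarrow> f i < f j"
    and "\<And>x i. x \<in> carrier_vec k \<Longrightarrow> i < k \<Longrightarrow> (A\<^sup>T *\<^sub>v x) $ f i = x $ i"
    and "\<And>x. x \<in> carrier_vec k \<Longrightarrow> x \<noteq> 0\<^sub>v k \<Longrightarrow> (LEAST j. (A\<^sup>T *\<^sub>v x) $ j \<noteq> 0) \<in> f ` {..<k}"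
proof -
  have d: "dim_row A = k" using A by simp
  note p = pivot_funD[OF d p]
  show fv: "f i < v" if i: "i < k" for i
  proof (rule ccontr)
    assume "\<not> f i < v"
    \<comment> \<open>The value \<open>v\<close>, one past the last column, marks a zero row in
      \<open>pivot_fun\<close>.\<close>
    then have "f i = v" using p(1)[OF i] by simp
    then have "row A i = 0\<^sub>v v" using A i p(2)[OF i] by (intro eq_vecI) auto
    then have "A\<^sup>T *\<^sub>v unit_vec k i = A\<^sup>T *\<^sub>v 0\<^sub>v k"
      using A i by (intro eq_vecI) (simp_all add: transpose_mult_unit_vec scalar_prod_def)
    then have "unit_vec k i = (0\<^sub>v k :: 'a vec)" using inj by (auto dest: inj_onD)
    then show False using i by (metis index_unit_vec(1) index_zero_vec(1) zero_neq_one)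
  qed
  show mono: "f i < f j" if "i < j" "j < k" for i j
    using that
  proof (induction j)
    case (Suc j)
    then have "f j < f (Suc j)" using p(3)[of j] fv[of "Suc j"] by auto
    then show ?case using Suc by (cases "i = j") auto
  qed simp
  show val: "(A\<^sup>T *\<^sub>v x) $ f i = x $ i" if x: "x \<in> carrier_vec k" and i: "i < k" for x i
  proof -
    have "(A\<^sup>T *\<^sub>v x) $ f i = (\<Sum>l<k. A $$ (l, f i) * x $ l)"
      using index_transpose_mult_vec[OF A x fv[OF i]] .
    also have "\<dots> = (\<Sum>l<k. if l = i then x $ l else 0)"
      using p(4)[OF i fv[OF i]] p(5)[OF i fv[OF i]] by (intro sum.cong) auto
    finally show ?thesis using i by simp
  qed
  show "(LEAST j. (A\<^sup>T *\<^sub>v x) $ j \<noteq> 0) \<in> f ` {..<k}"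
    if x: "x \<in> carrier_vec k" and nz: "x \<noteq> 0\<^sub>v k" for x
  proof -
    have ex: "\<exists>i. i < k \<and> x $ i \<noteq> 0" using x nz by (metis carrier_vecD eq_vecI index_zero_vec)
    define i where "i = (LEAST i. i < k \<and> x $ i \<noteq> 0)"
    have i: "i < k" "x $ i \<noteq> 0" using LeastI_ex[OF ex] by (auto simp: i_def)
    have below: "x $ l = 0" if "l < i" for l
      using not_less_Least[of l "\<lambda>i. i < k \<and> x $ i \<noteq> 0"] that i(1) by (auto simp: i_def)
    have "(LEAST j. (A\<^sup>T *\<^sub>v x) $ j \<noteq> 0) = f i"
    proof (rule Least_equality)
      show "(A\<^sup>T *\<^sub>v x) $ f i \<noteq> 0" using val[OF x i(1)] i(2) by simp
    next
      fix j assume nz: "(A\<^sup>T *\<^sub>v x) $ j \<noteq> 0"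
      show "f i \<le> j"
      proof (rule ccontr)
        assume "\<not> f i \<le> j"
        then have j: "j < f i" by simp
        \<comment> \<open>Rows before \<open>i\<close> have coefficient zero; rows from
          \<open>i\<close> on have their pivot at \<open>f i\<close> or later and vanish in column
          \<open>j\<close>.\<close>
        have "A $$ (l, j) * x $ l = 0" if l: "l < k" for l
        proof (cases "l < i")
          case False
          then have "f i \<le> f l" using mono[of i l] l by (cases "l = i") auto
          then show ?thesis using p(2)[OF l] j by auto
        qed (simp add: below)
        then have "(\<Sum>l<k. A $$ (l, j) * x $ l) = 0" by (intro sum.neutral) simp
        moreover have "j < v" using j fv[OF i(1)] by simp
        ultimately show False using nz index_transpose_mult_vec[OF A x] by simp
      qed
    qed
    then show ?thesis using i(1) by simp
  qed
qed

text \<open>The pivot columns are the positions of the leading entries of the nonzero vectors of the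
  row space, so they depend only on the row space.\<close>

lemma pivot_columns_subset:
  fixes A B :: "'a::field mat"
  assumes A: "A \<in> carrier_mat k v" and B: "B \<in> carrier_mat k v"
    and f: "pivot_fun A f v" and g: "pivot_fun B g v"
    and iA: "inj_on (\<lambda>x. A\<^sup>T *\<^sub>v x) (carrier_vec k)"
    and iB: "inj_on (\<lambda>x. B\<^sup>T *\<^sub>v x) (carrier_vec k)"
    and eq: "vec_space.row_space v A = vec_space.row_space v B"
  shows "f ` {..<k} \<subseteq> g ` {..<k}"
proof
  note pA = pivot_fun_full_rank[OF A f iA]
  note pB = pivot_fun_full_rank[OF B g iB]
  fix j assume "j \<in> f ` {..<k}"
  then obtain i where i: "i < k" "j = f i" by auto
  let ?w = "A\<^sup>T *\<^sub>v unit_vec k i"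
  have "?w \<in> vec_space.row_space v B" unfolding eq[symmetric] row_space_image[OF A] by auto
  then obtain x where x: "x \<in> carrier_vec k" "?w = B\<^sup>T *\<^sub>v x"
    unfolding row_space_image[OF B] by auto
  have w: "?w $ f i = 1" using pA(3)[of "unit_vec k i" i] i by simp
  have "x \<noteq> 0\<^sub>v k"
  proof
    assume "x = 0\<^sub>v k"
    then have "?w $ f i = 0" using x index_transpose_mult_vec[OF B x(1)] pA(1) i by simp
    with w show False by simp
  qed
  then have "(LEAST j. ?w $ j \<noteq> 0) \<in> g ` {..<k}" using pB(4) x by simp
  moreover have "(LEAST j. ?w $ j \<noteq> 0) = f i"
  proof (rule Least_equality)
    show "?w $ f i \<noteq> 0" using w by simp
    fix j assume nz: "?w $ j \<noteq> 0"
    show "f i \<le> j"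
    proof (rule ccontr)
      assume j: "\<not> f i \<le> j"
      then have "j < v" using pA(1)[OF i(1)] by simp
      then have "?w $ j = A $$ (i, j)"
        unfolding transpose_mult_unit_vec[OF A i(1)] using A i by simp
      then show False using nz j i A f by (auto simp: pivot_fun_def)
    qed
  qed
  ultimately show "j \<in> g ` {..<k}" using i by simp
qed

text \<open>Both matrices have the same pivot columns. Writing a row of \<open>B\<close> as a
  combination of rows of \<open>A\<close> and reading it at these columns shows that the coefficient
  vector is a unit vector, so the rows agree.\<close>

lemma row_echelon_form_unique:
  fixes A B :: "'a::field mat"
  assumes A: "A \<in> carrier_mat k v" and B: "B \<in> carrier_mat k v"
    and eA: "row_echelon_form A" and eB: "row_echelon_form B"
    and iA: "inj_on (\<lambda>x. A\<^sup>T *\<^sub>v x) (carrier_vec k)"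
    and iB: "inj_on (\<lambda>x. B\<^sup>T *\<^sub>v x) (carrier_vec k)"
    and eq: "vec_space.row_space v A = vec_space.row_space v B"
  shows "A = B"
proof -
  obtain f g where f: "pivot_fun A f v" and g: "pivot_fun B g v"
    using eA eB A B by (auto simp: row_echelon_form_def)
  note pA = pivot_fun_full_rank[OF A f iA]
  note pB = pivot_fun_full_rank[OF B g iB]
  have "f ` {..<k} = g ` {..<k}"
    using pivot_columns_subset[OF A B f g iA iB eq]
      pivot_columns_subset[OF B A g f iB iA eq[symmetric]] by blast
  \<comment> \<open>A strictly increasing list is determined by its set of entries, so equality of
    the pivot sets gives equality of the pivot functions.\<close>
  moreover have "sorted_wrt (<) (map f [0..<k])" "sorted_wrt (<) (map g [0..<k])"
    using pA(2) pB(2) by (simp_all add: sorted_wrt_iff_nth_less)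
  ultimately have "map f [0..<k] = map g [0..<k]"
    by (intro strict_sorted_equal) (auto simp: lessThan_atLeast0)
  then have fg: "f i = g i" if "i < k" for i using that by simp
  show ?thesis
  proof (rule eq_rowI)
    fix i assume "i < dim_row B"
    then have i: "i < k" using B by simp
    have "B\<^sup>T *\<^sub>v unit_vec k i \<in> vec_space.row_space v A"
      unfolding eq row_space_image[OF B] by auto
    then obtain x where x: "x \<in> carrier_vec k" "B\<^sup>T *\<^sub>v unit_vec k i = A\<^sup>T *\<^sub>v x"
      unfolding row_space_image[OF A] by auto
    have "x = unit_vec k i"
    proof (rule eq_vecI)
      fix l assume "l < dim_vec (unit_vec k i :: 'a vec)"
      then have l: "l < k" by simp
      show "x $ l = unit_vec k i $ l"
        using pA(3)[OF x(1) l] pB(3)[of "unit_vec k i" l] l x(2) fg[OF l] by simp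
    qed (use x in simp)
    then show "row A i = row B i"
      using x transpose_mult_unit_vec A B i by metis
  qed (use A B in auto)
qed

text \<open>The definite description is justified here: Gauss-Jordan elimination of a matrix whose
  rows form a basis gives existence, since invertible row operations keep the row space, and the
  preceding lemma gives uniqueness.\<close>

lemma tau:
  fixes U :: "'a::{field,finite} vec set"
  assumes U: "is_subspace v U" and k: "sdim v U = k"
  shows "tau v U \<in> carrier_mat k v" "vec_space.row_space v (tau v U) = U"
    "inj_on (\<lambda>x. (tau v U)\<^sup>T *\<^sub>v x) (carrier_vec k)"
proof -
  interpret vec_space "TYPE('a)" v .
  obtain B where B: "finite B" "card B = k" "B \<subseteq> U" "span B = U" "card U = CARD('a) ^ card B"
    using subspace_basis[OF U] k by metis
  have UC: "U \<subseteq> carrier_vec v" using U by (simp add: is_subspace_iff)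
  obtain bs where bs: "set bs = B" "distinct bs" using finite_distinct_list[OF B(1)] by auto
  then have len: "length bs = k" using B(2) distinct_card by fastforce
  define A where "A = mat_of_rows v bs"
  have A: "A \<in> carrier_mat k v" unfolding A_def len[symmetric] by (rule mat_of_rows_carrier)
  have rsA: "row_space A = U"
    unfolding row_space_def A_def using bs B UC by (simp add: rows_mat_of_rows)
  define C where "C = gauss_jordan_single A"
  note gj = gauss_jordan_single[OF A C_def[symmetric]]
  obtain P Q where PQ: "C = P * A" "P \<in> carrier_mat k k" "Q \<in> carrier_mat k k"
    "P * Q = 1\<^sub>m k" "Q * P = 1\<^sub>m k" using gj(4) by auto
  have "invertible_mat P"
    unfolding invertible_mat_def inverts_mat_def using PQ by auto
  then have rsC: "row_space C = U"
    using row_space_is_preserved[OF _ PQ(2) A] rsA PQ(1) by simp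
  have inj: "inj_on (\<lambda>x. D\<^sup>T *\<^sub>v x) (carrier_vec k)" if "D \<in> carrier_mat k v" "row_space D = U" for D
    using inj_on_row_comb[OF that(1)] that(2) B by simp
  let ?P = "\<lambda>A. A \<in> carrier_mat (sdim v U) v \<and> row_echelon_form A \<and> row_space A = U"
  have "\<exists>!A. ?P A"
  proof (intro ex1I[of _ C] conjI)
    fix D assume D: "?P D"
    then have D': "D \<in> carrier_mat k v" by (simp add: k)
    show "D = C"
      by (rule row_echelon_form_unique[OF D' gj(2)])
        (use D D' gj(2,3) rsC inj in auto)
  qed (use gj(2,3) rsC k in auto)
  then have "?P (tau v U)" unfolding tau_def by (rule theI')
  then show 1: "tau v U \<in> carrier_mat k v" and 2: "row_space (tau v U) = U" by (auto simp: k)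
  show "inj_on (\<lambda>x. (tau v U)\<^sup>T *\<^sub>v x) (carrier_vec k)" using inj[OF 1 2] .
qed

section \<open>Subspace and rank distance\<close>

text \<open>The exponent of the cardinality of the intersection is its dimension. The bound
  \<open>s \<le> k\<close> ensures that the subtraction is exact.\<close>

lemma subspace_dist_eq:
  fixes U W :: "'a::{field,finite} vec set"
  assumes U: "is_subspace v U" "sdim v U = k" and W: "is_subspace v W" "sdim v W = k"
    and card: "card (U \<inter> W) = CARD('a) ^ s"
  shows "s \<le> k" "subspace_dist v U W = 2 * (k - s)"
proof -
  have q: "1 < CARD('a)" by (rule CARD_field_gt_1)
  have "sdim v (U \<inter> W) = s"
    using card_subspace[OF is_subspace_Int[OF U(1) W(1)]] card q by simp
  then show "subspace_dist v U W = 2 * (k - s)"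
    using U W by (simp add: subspace_dist_def)
  have "card (U \<inter> W) \<le> card U" using finite_subspace[OF U(1)] by (intro card_mono) auto
  then show "s \<le> k" using card card_subspace[OF U(1)] U(2) q by simp
qed

text \<open>The two pairs may live in different ambient spaces, so codewords can be compared with
  the subspaces they are built from.\<close>

lemma subspace_dist_antimono:
  fixes U W X Y :: "'a::{field,finite} vec set"
  assumes U: "is_subspace v U" "sdim v U = k" and W: "is_subspace v W" "sdim v W = k"
    and X: "is_subspace n X" "sdim n X = k" and Y: "is_subspace n Y" "sdim n Y = k"
    and le: "card (X \<inter> Y) \<le> card (U \<inter> W)"
  shows "subspace_dist v U W \<le> subspace_dist n X Y"
proof -
  have q: "1 < CARD('a)" by (rule CARD_field_gt_1)
  note UW = card_subspace[OF is_subspace_Int[OF U(1) W(1)]]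
  note XY = card_subspace[OF is_subspace_Int[OF X(1) Y(1)]]
  have "sdim n (X \<inter> Y) \<le> sdim v (U \<inter> W)" using le q unfolding UW XY by simp
  then show ?thesis
    using subspace_dist_eq(2)[OF U W UW] subspace_dist_eq(2)[OF X Y XY] by simp
qed

lemma subspace_dist_cong:
  fixes U W X Y :: "'a::{field,finite} vec set"
  assumes "is_subspace v U" "sdim v U = k" "is_subspace v W" "sdim v W = k"
    and "is_subspace n X" "sdim n X = k" "is_subspace n Y" "sdim n Y = k"
    and "card (X \<inter> Y) = card (U \<inter> W)"
  shows "subspace_dist n X Y = subspace_dist v U W"
  using assms by (intro antisym; intro subspace_dist_antimono[where k = k]) simp_all

lemma subspace_dist_ge:
  fixes U W :: "'a::{field,finite} vec set"
  assumes U: "is_subspace v U" "sdim v U = k" and W: "is_subspace v W" "sdim v W = k"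
    and le: "card (U \<inter> W) \<le> CARD('a) ^ e"
  shows "2 * (k - e) \<le> subspace_dist v U W"
proof -
  note UW = card_subspace[OF is_subspace_Int[OF U(1) W(1)]]
  have "sdim v (U \<inter> W) \<le> e" using le CARD_field_gt_1[where 'a='a] unfolding UW by simp
  then show ?thesis using subspace_dist_eq(2)[OF U W UW] by simp
qed

lemma subspace_dist_commute: "subspace_dist v U W = subspace_dist v W U"
  by (simp add: subspace_dist_def Int_commute add.commute)

lemma subspace_dist_le: "sdim v U = k \<Longrightarrow> sdim v W = k \<Longrightarrow> subspace_dist v U W \<le> 2 * k"
  by (simp add: subspace_dist_def)

text \<open>An intersection of full dimension has as many elements as each of the two subspaces and
  therefore equals both.\<close>

lemma subspace_dist_pos:
  fixes U W :: "'a::{field,finite} vec set"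
  assumes U: "is_subspace v U" "sdim v U = k" and W: "is_subspace v W" "sdim v W = k"
    and ne: "U \<noteq> W"
  shows "0 < subspace_dist v U W"
proof -
  note UW = card_subspace[OF is_subspace_Int[OF U(1) W(1)]]
  have "\<not> k \<le> sdim v (U \<inter> W)"
  proof
    assume "k \<le> sdim v (U \<inter> W)"
    then have "card (U \<inter> W) = CARD('a) ^ k" using UW subspace_dist_eq(1)[OF U W UW] by simp
    then have "U \<inter> W = U" "U \<inter> W = W"
      using card_subspace[OF U(1)] card_subspace[OF W(1)] U W finite_subspace
      by (metis card_subset_eq inf_le1, metis card_subset_eq inf_le2)
    with ne show False by simp
  qed
  then show ?thesis using subspace_dist_eq(2)[OF U W UW] by simp
qed

lemma subspace_dist_self: "subspace_dist v U U = 0"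
  by (simp add: subspace_dist_def)

text \<open>If the difference has rank zero, its left kernel is everything; applying this to unit
  vectors shows that all its rows vanish.\<close>

lemma rank_dist_pos:
  fixes A B :: "'a::{field,finite} mat"
  assumes A: "A \<in> carrier_mat k n" and B: "B \<in> carrier_mat k n" and ne: "A \<noteq> B"
  shows "0 < rank_dist k A B"
proof (rule ccontr)
  assume "\<not> 0 < rank_dist k A B"
  then have r: "vec_space.rank k (A - B) = 0" by (simp add: rank_dist_def)
  have D: "A - B \<in> carrier_mat k n" using A B by auto
  let ?K = "{x \<in> carrier_vec k. (A - B)\<^sup>T *\<^sub>v x = 0\<^sub>v n}"
  have "?K = carrier_vec k"
    using card_left_kernel[OF D] r by (intro card_subset_eq) (auto simp: card_carrier_vec)
  then have K: "(A - B)\<^sup>T *\<^sub>v x = 0\<^sub>v n" if "x \<in> carrier_vec k" for x using that by auto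
  have "A $$ (i, j) = B $$ (i, j)" if "i < k" "j < n" for i j
  proof -
    have "row (A - B) i $ j = 0"
      using K[of "unit_vec k i"] transpose_mult_unit_vec[OF D that(1)] that by simp
    then show ?thesis using A B that by simp
  qed
  then show False using ne A B by (metis carrier_matD eq_matI)
qed

lemma row_space_full_rank:
  fixes A :: "'a::{field,finite} mat"
  assumes A: "A \<in> carrier_mat k n" and inj: "inj_on (\<lambda>x. A\<^sup>T *\<^sub>v x) (carrier_vec k)"
  shows "is_subspace n (vec_space.row_space n A)" "sdim n (vec_space.row_space n A) = k"
proof -
  show S: "is_subspace n (vec_space.row_space n A)" by (rule is_subspace_row_space[OF A])
  have "card (vec_space.row_space n A) = CARD('a) ^ k"
    unfolding row_space_image[OF A] using inj by (simp add: card_image card_carrier_vec)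
  then show "sdim n (vec_space.row_space n A) = k"
    using card_subspace[OF S] CARD_field_gt_1[where 'a='a] by simp
qed

section \<open>Concatenation\<close>

lemma hconcat_carrier:
  "A \<in> carrier_mat k a \<Longrightarrow> B \<in> carrier_mat k b \<Longrightarrow> hconcat A B \<in> carrier_mat k (a + b)"
  unfolding hconcat_def by auto

lemma transpose_hconcat_mult_vec:
  assumes A: "A \<in> carrier_mat k a" and B: "B \<in> carrier_mat k b" and x: "x \<in> carrier_vec k"
  shows "(hconcat A B)\<^sup>T *\<^sub>v x = (A\<^sup>T *\<^sub>v x) @\<^sub>v (B\<^sup>T *\<^sub>v x)"
proof (rule eq_vecI)
  fix i assume "i < dim_vec ((A\<^sup>T *\<^sub>v x) @\<^sub>v (B\<^sup>T *\<^sub>v x))"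
  then have i: "i < a + b" using A B by simp
  have "((hconcat A B)\<^sup>T *\<^sub>v x) $ i = (\<Sum>l<k. hconcat A B $$ (l, i) * x $ l)"
    using index_transpose_mult_vec[OF hconcat_carrier[OF A B] x i] .
  also have "\<dots> = (\<Sum>l<k. (if i < a then A $$ (l, i) else B $$ (l, i - a)) * x $ l)"
    using A B i by (intro sum.cong) (auto simp: hconcat_def)
  also have "\<dots> = ((A\<^sup>T *\<^sub>v x) @\<^sub>v (B\<^sup>T *\<^sub>v x)) $ i"
    using A B i x by (auto simp: index_transpose_mult_vec[OF A] index_transpose_mult_vec[OF B]
        simp del: index_mult_mat_vec)
  finally show "((hconcat A B)\<^sup>T *\<^sub>v x) $ i = ((A\<^sup>T *\<^sub>v x) @\<^sub>v (B\<^sup>T *\<^sub>v x)) $ i" .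
qed (use hconcat_carrier[OF A B] A B in auto)

lemma tau_inv_hconcat:
  fixes A B :: "'a::{field,finite} mat"
  assumes A: "A \<in> carrier_mat k a" and B: "B \<in> carrier_mat k b"
  shows "tau_inv (hconcat A B) = (\<lambda>x. (A\<^sup>T *\<^sub>v x) @\<^sub>v (B\<^sup>T *\<^sub>v x)) ` carrier_vec k"
proof -
  have "tau_inv (hconcat A B) = (\<lambda>x. (hconcat A B)\<^sup>T *\<^sub>v x) ` carrier_vec k"
    using row_space_image[OF hconcat_carrier[OF A B]] hconcat_carrier[OF A B]
    by (simp add: tau_inv_def)
  then show ?thesis using transpose_hconcat_mult_vec[OF A B] by (simp cong: image_cong)
qed

text \<open>One injective block suffices for the concatenation. The disjunction covers both kinds of
  codewords: the left block is injective for the first kind, the right block for the second.\<close>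

lemma hconcat_subspace:
  fixes A B :: "'a::{field,finite} mat"
  assumes A: "A \<in> carrier_mat k a" and B: "B \<in> carrier_mat k b"
    and inj: "inj_on (\<lambda>x. A\<^sup>T *\<^sub>v x) (carrier_vec k) \<or> inj_on (\<lambda>x. B\<^sup>T *\<^sub>v x) (carrier_vec k)"
  shows "is_subspace (a + b) (tau_inv (hconcat A B))" "sdim (a + b) (tau_inv (hconcat A B)) = k"
proof -
  note C = hconcat_carrier[OF A B]
  have "x = y" if x: "x \<in> carrier_vec k" "y \<in> carrier_vec k"
    and eq: "(hconcat A B)\<^sup>T *\<^sub>v x = (hconcat A B)\<^sup>T *\<^sub>v y" for x y
  proof -
    have c: "A\<^sup>T *\<^sub>v x \<in> carrier_vec a" "A\<^sup>T *\<^sub>v y \<in> carrier_vec a"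
      unfolding carrier_vec_def using A by auto
    have "A\<^sup>T *\<^sub>v x = A\<^sup>T *\<^sub>v y \<and> B\<^sup>T *\<^sub>v x = B\<^sup>T *\<^sub>v y"
      using eq append_vec_eq[OF c] by (simp add: transpose_hconcat_mult_vec[OF A B] x)
    then show ?thesis using inj x by (auto dest: inj_onD)
  qed
  then have "inj_on (\<lambda>x. (hconcat A B)\<^sup>T *\<^sub>v x) (carrier_vec k)" by (auto intro: inj_onI)
  note * = row_space_full_rank[OF C this]
  have "tau_inv (hconcat A B) = vec_space.row_space (a + b) (hconcat A B)"
    using C by (simp add: tau_inv_def)
  with * show "is_subspace (a + b) (tau_inv (hconcat A B))"
    "sdim (a + b) (tau_inv (hconcat A B)) = k" by simp_all
qed

lemma vec_first_append: "v \<in> carrier_vec n \<Longrightarrow> vec_first (v @\<^sub>v w) n = v"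
  by (intro eq_vecI) (auto simp: vec_first_def)

text \<open>Restriction to the first \<open>a\<close> coordinates sends the intersection of the
  codewords into that of the row spaces. It is injective because the left part
  \<open>A\<^sup>T *\<^sub>v x\<close> already determines \<open>x\<close>.\<close>

lemma hconcat_dist_ge:
  fixes A B :: "'a::{field,finite} mat"
  assumes A: "A \<in> carrier_mat k a" "inj_on (\<lambda>x. A\<^sup>T *\<^sub>v x) (carrier_vec k)"
    and A': "A' \<in> carrier_mat k a" "inj_on (\<lambda>x. A'\<^sup>T *\<^sub>v x) (carrier_vec k)"
    and B: "B \<in> carrier_mat k b" and B': "B' \<in> carrier_mat k b"
  shows "subspace_dist a (vec_space.row_space a A) (vec_space.row_space a A')
    \<le> subspace_dist (a + b) (tau_inv (hconcat A B)) (tau_inv (hconcat A' B'))"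
proof -
  let ?X = "tau_inv (hconcat A B)" and ?Y = "tau_inv (hconcat A' B')"
  have "card (?X \<inter> ?Y) \<le> card (vec_space.row_space a A \<inter> vec_space.row_space a A')"
  proof (rule card_inj_on_le)
    show "inj_on (\<lambda>z. vec_first z a) (?X \<inter> ?Y)"
    proof (rule inj_on_subset)
      show "inj_on (\<lambda>z. vec_first z a) ?X"
        using A by (auto simp: tau_inv_hconcat[OF A(1) B] inj_on_def vec_first_append)
    qed simp
    show "(\<lambda>z. vec_first z a) ` (?X \<inter> ?Y) \<subseteq> vec_space.row_space a A \<inter> vec_space.row_space a A'"
    proof -
      have "(\<lambda>z. vec_first z a) ` ?X \<subseteq> vec_space.row_space a A"
        using A(1) by (auto simp: tau_inv_hconcat[OF A(1) B] row_space_image[OF A(1)] vec_first_append)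
      moreover have "(\<lambda>z. vec_first z a) ` ?Y \<subseteq> vec_space.row_space a A'"
        using A'(1) by (auto simp: tau_inv_hconcat[OF A'(1) B'] row_space_image[OF A'(1)] vec_first_append)
      ultimately show ?thesis by auto
    qed
    show "finite (vec_space.row_space a A \<inter> vec_space.row_space a A')"
      using finite_subspace[OF is_subspace_row_space[OF A(1)]] by simp
  qed
  then show ?thesis
    using A A' B B' by (intro subspace_dist_antimono[where k = k] row_space_full_rank hconcat_subspace) auto
qed

text \<open>Equal left parts force equal coefficient vectors, so a common vector amounts to an
  element of the left kernel of \<open>B - B'\<close>.\<close>

lemma hconcat_dist_same_left:
  fixes A B :: "'a::{field,finite} mat"
  assumes A: "A \<in> carrier_mat k a" "inj_on (\<lambda>x. A\<^sup>T *\<^sub>v x) (carrier_vec k)"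
    and B: "B \<in> carrier_mat k b" and B': "B' \<in> carrier_mat k b"
  shows "subspace_dist (a + b) (tau_inv (hconcat A B)) (tau_inv (hconcat A B')) = 2 * rank_dist k B B'"
proof -
  let ?X = "tau_inv (hconcat A B)" and ?Y = "tau_inv (hconcat A B')"
  let ?K = "{x \<in> carrier_vec k. (B - B')\<^sup>T *\<^sub>v x = 0\<^sub>v b}"
  let ?r = "rank_dist k B B'"
  have D: "B - B' \<in> carrier_mat k b" using B B' by auto
  have c: "A\<^sup>T *\<^sub>v x \<in> carrier_vec a" for x
    unfolding carrier_vec_def using A(1) by auto
  have K: "?K = {x \<in> carrier_vec k. B\<^sup>T *\<^sub>v x = B'\<^sup>T *\<^sub>v x}"
  proof -
    have "(B - B')\<^sup>T *\<^sub>v x = 0\<^sub>v b \<longleftrightarrow> B\<^sup>T *\<^sub>v x = B'\<^sup>T *\<^sub>v x" if "x \<in> carrier_vec k" for x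
    proof -
      have "(B - B')\<^sup>T *\<^sub>v x = B\<^sup>T *\<^sub>v x - B'\<^sup>T *\<^sub>v x"
        using B B' that by (simp add: transpose_minus minus_mult_distrib_mat_vec[of _ b k])
      then show ?thesis using B B' by (auto simp: vec_eq_iff)
    qed
    then show ?thesis by auto
  qed
  have "?X \<inter> ?Y = (\<lambda>x. (A\<^sup>T *\<^sub>v x) @\<^sub>v (B\<^sup>T *\<^sub>v x)) ` ?K"
  proof (intro equalityI subsetI)
    fix z assume "z \<in> ?X \<inter> ?Y"
    then obtain x y where xy: "x \<in> carrier_vec k" "y \<in> carrier_vec k"
      "z = (A\<^sup>T *\<^sub>v x) @\<^sub>v (B\<^sup>T *\<^sub>v x)" "z = (A\<^sup>T *\<^sub>v y) @\<^sub>v (B'\<^sup>T *\<^sub>v y)"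
      by (auto simp: tau_inv_hconcat[OF A(1) B] tau_inv_hconcat[OF A(1) B'])
    then have eq: "A\<^sup>T *\<^sub>v x = A\<^sup>T *\<^sub>v y" "B\<^sup>T *\<^sub>v x = B'\<^sup>T *\<^sub>v y"
      using append_vec_eq[OF c c] by metis+
    then have "x = y" using inj_onD[OF A(2)] xy by blast
    then show "z \<in> (\<lambda>x. (A\<^sup>T *\<^sub>v x) @\<^sub>v (B\<^sup>T *\<^sub>v x)) ` ?K"
      unfolding K by (intro image_eqI[of _ _ x]) (use xy eq in simp_all)
  next
    fix z assume "z \<in> (\<lambda>x. (A\<^sup>T *\<^sub>v x) @\<^sub>v (B\<^sup>T *\<^sub>v x)) ` ?K"
    then obtain x where x: "x \<in> carrier_vec k" "B\<^sup>T *\<^sub>v x = B'\<^sup>T *\<^sub>v x"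
      "z = (A\<^sup>T *\<^sub>v x) @\<^sub>v (B\<^sup>T *\<^sub>v x)" unfolding K by auto
    then show "z \<in> ?X \<inter> ?Y"
      unfolding tau_inv_hconcat[OF A(1) B] tau_inv_hconcat[OF A(1) B']
      by (intro IntI image_eqI[of _ _ x]; simp only:)
  qed
  moreover have "inj_on (\<lambda>x. (A\<^sup>T *\<^sub>v x) @\<^sub>v (B\<^sup>T *\<^sub>v x)) ?K"
    using A(2) append_vec_eq[OF c c] by (auto simp: inj_on_def)
  ultimately have KXY: "card ?K = card (?X \<inter> ?Y)" by (simp add: card_image)
  note X = hconcat_subspace[OF A(1) B disjI1[OF A(2)]]
  note Y = hconcat_subspace[OF A(1) B' disjI1[OF A(2)]]
  note XY = card_subspace[OF is_subspace_Int[OF X(1) Y(1)]]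
  \<comment> \<open>Comparing exponents in the left kernel formula gives dimension plus rank equal
    to \<open>k\<close>.\<close>
  have "CARD('a) ^ (sdim (a + b) (?X \<inter> ?Y) + ?r) = CARD('a) ^ k"
    using card_left_kernel[OF D] unfolding KXY XY rank_dist_def by (simp add: power_add)
  then have "sdim (a + b) (?X \<inter> ?Y) + ?r = k" using CARD_field_gt_1[where 'a='a] by simp
  then show ?thesis using subspace_dist_eq(2)[OF X Y XY] by simp
qed

text \<open>Appending zeros is injective and so commutes with intersection. This gives codewords
  that realise distances of \<open>C1\<close> exactly.\<close>

lemma hconcat_dist_zero_right:
  fixes A A' :: "'a::{field,finite} mat"
  assumes A: "A \<in> carrier_mat k a" "inj_on (\<lambda>x. A\<^sup>T *\<^sub>v x) (carrier_vec k)"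
    and A': "A' \<in> carrier_mat k a" "inj_on (\<lambda>x. A'\<^sup>T *\<^sub>v x) (carrier_vec k)"
  shows "subspace_dist (a + b) (tau_inv (hconcat A (0\<^sub>m k b))) (tau_inv (hconcat A' (0\<^sub>m k b)))
    = subspace_dist a (vec_space.row_space a A) (vec_space.row_space a A')"
proof -
  let ?Z = "0\<^sub>m k b :: 'a mat" and ?h = "\<lambda>w :: 'a vec. w @\<^sub>v 0\<^sub>v b"
  have Z: "?Z \<in> carrier_mat k b" by simp
  have im: "tau_inv (hconcat M ?Z) = ?h ` vec_space.row_space a M" if "M \<in> carrier_mat k a" for M
    unfolding tau_inv_hconcat[OF that Z] row_space_image[OF that] image_image
    by (intro image_cong) auto
  have inj: "inj_on ?h (carrier_vec a)" by (auto simp: inj_on_def)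
  moreover have sub: "vec_space.row_space a A \<subseteq> carrier_vec a" "vec_space.row_space a A' \<subseteq> carrier_vec a"
    using is_subspace_row_space[OF A(1)] is_subspace_row_space[OF A'(1)] by (auto simp: is_subspace_iff)
  ultimately have "tau_inv (hconcat A ?Z) \<inter> tau_inv (hconcat A' ?Z)
      = ?h ` (vec_space.row_space a A \<inter> vec_space.row_space a A')"
    unfolding im[OF A(1)] im[OF A'(1)] by (rule inj_on_image_Int[symmetric])
  moreover have "inj_on ?h (vec_space.row_space a A \<inter> vec_space.row_space a A')"
    using inj_on_subset[OF inj] sub by blast
  ultimately have "card (tau_inv (hconcat A ?Z) \<inter> tau_inv (hconcat A' ?Z))
      = card (vec_space.row_space a A \<inter> vec_space.row_space a A')" by (simp add: card_image)
  then show ?thesis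
    using A A' by (intro subspace_dist_cong[where k = k] row_space_full_rank hconcat_subspace) auto
qed

lemma hconcat_dist_zero_left:
  fixes B B' :: "'a::{field,finite} mat"
  assumes B: "B \<in> carrier_mat k b" "inj_on (\<lambda>x. B\<^sup>T *\<^sub>v x) (carrier_vec k)"
    and B': "B' \<in> carrier_mat k b" "inj_on (\<lambda>x. B'\<^sup>T *\<^sub>v x) (carrier_vec k)"
  shows "subspace_dist (a + b) (tau_inv (hconcat (0\<^sub>m k a) B)) (tau_inv (hconcat (0\<^sub>m k a) B'))
    = subspace_dist b (vec_space.row_space b B) (vec_space.row_space b B')"
proof -
  let ?Z = "0\<^sub>m k a :: 'a mat" and ?h = "\<lambda>w :: 'a vec. 0\<^sub>v a @\<^sub>v w"
  have Z: "?Z \<in> carrier_mat k a" by simp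
  have im: "tau_inv (hconcat ?Z M) = ?h ` vec_space.row_space b M" if "M \<in> carrier_mat k b" for M
    unfolding tau_inv_hconcat[OF Z that] row_space_image[OF that] image_image
    by (intro image_cong) auto
  have inj: "inj ?h"
    using append_vec_eq[of "0\<^sub>v a" a "0\<^sub>v a"] by (auto simp: inj_on_def)
  then have "tau_inv (hconcat ?Z B) \<inter> tau_inv (hconcat ?Z B')
      = ?h ` (vec_space.row_space b B \<inter> vec_space.row_space b B')"
    unfolding im[OF B(1)] im[OF B'(1)] by (rule image_Int[symmetric])
  then have "card (tau_inv (hconcat ?Z B) \<inter> tau_inv (hconcat ?Z B'))
      = card (vec_space.row_space b B \<inter> vec_space.row_space b B')"
    using card_image[OF inj_on_subset[OF inj subset_UNIV]] by simp
  then show ?thesis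
    using B B' by (intro subspace_dist_cong[where k = k] row_space_full_rank hconcat_subspace) auto
qed

text \<open>A vector of the intersection is determined by the \<open>e\<close> coordinates of the left block that lie
  outside the zero block.\<close>

lemma hconcat_dist_overlap:
  fixes A B :: "'a::{field,finite} mat"
  assumes A: "A \<in> carrier_mat k a" "inj_on (\<lambda>x. A\<^sup>T *\<^sub>v x) (carrier_vec k)"
    and M: "M \<in> carrier_mat k b"
    and B: "B \<in> carrier_mat k b'" "inj_on (\<lambda>x. B\<^sup>T *\<^sub>v x) (carrier_vec k)"
    and n: "a + b = n" "a' + b' = n" and e: "a \<le> a' + e" "e \<le> a"
  shows "2 * (k - e) \<le> subspace_dist n (tau_inv (hconcat A M)) (tau_inv (hconcat (0\<^sub>m k a') B))"
proof -
  let ?X = "tau_inv (hconcat A M)" and ?Y = "tau_inv (hconcat (0\<^sub>m k a') B)"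
  \<comment> \<open>The window covers positions \<open>a - e\<close> to \<open>a - 1\<close>;
    \<open>e \<le> a\<close> makes the subtraction exact, and all earlier positions fall into the
    zero block.\<close>
  let ?h = "\<lambda>z :: 'a vec. vec e (\<lambda>i. z $ (a - e + i))"
  have Z: "0\<^sub>m k a' \<in> carrier_mat k a'" by simp
  have zero: "z $ i = 0" if "z \<in> ?Y" "i < a - e" for z i
    using that e B(1) by (auto simp: tau_inv_hconcat[OF Z B(1)])
  have "inj_on ?h (?X \<inter> ?Y)"
  proof (rule inj_onI)
    fix z w assume z: "z \<in> ?X \<inter> ?Y" and w: "w \<in> ?X \<inter> ?Y" and eq: "?h z = ?h w"
    have "vec_first z a = vec_first w a"
    proof (rule eq_vecI)
      fix i assume "i < dim_vec (vec_first w a)"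
      then have i: "i < a" by simp
      have "z $ i = w $ i"
      proof (cases "i < a - e")
        case False
        define l where "l = i - (a - e)"
        have l: "i = a - e + l" "l < e" using False i unfolding l_def by linarith+
        have "?h z $ l = ?h w $ l" by (simp only: eq)
        then show ?thesis using l by (simp only: index_vec)
      qed (use zero z w in auto)
      then show "vec_first z a $ i = vec_first w a $ i" using i by (simp add: vec_first_def)
    qed simp
    moreover obtain x y where xy: "x \<in> carrier_vec k" "y \<in> carrier_vec k"
      "z = (A\<^sup>T *\<^sub>v x) @\<^sub>v (M\<^sup>T *\<^sub>v x)" "w = (A\<^sup>T *\<^sub>v y) @\<^sub>v (M\<^sup>T *\<^sub>v y)"
      using z w by (auto simp: tau_inv_hconcat[OF A(1) M])
    moreover have "A\<^sup>T *\<^sub>v u \<in> carrier_vec a" for u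
      unfolding carrier_vec_def using A(1) by auto
    ultimately have "A\<^sup>T *\<^sub>v x = A\<^sup>T *\<^sub>v y" by (simp only: vec_first_append)
    then have "x = y" using inj_onD[OF A(2)] xy(1,2) by blast
    then show "z = w" using xy(3,4) by simp
  qed
  then have "card (?X \<inter> ?Y) \<le> card (carrier_vec e :: 'a vec set)"
    by (rule card_inj_on_le) auto
  then show ?thesis
    using hconcat_subspace[OF A(1) M disjI1[OF A(2)]] hconcat_subspace[OF Z B(1) disjI2[OF B(2)]] n
    by (intro subspace_dist_ge) (auto simp: card_carrier_vec)
qed

section \<open>Minimum distance\<close>

lemma has_min_dist_le:
  "has_min_dist \<delta> C d \<Longrightarrow> x \<in> C \<Longrightarrow> y \<in> C \<Longrightarrow> x \<noteq> y \<Longrightarrow> d \<le> enat (\<delta> x y)"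
  by (auto simp: has_min_dist_def card_1_singleton_iff split: if_splits)

lemma has_min_dist_attained:
  assumes "has_min_dist \<delta> C (enat d)"
  obtains x y where "x \<in> C" "y \<in> C" "x \<noteq> y" "d = \<delta> x y"
  using assms by (auto simp: has_min_dist_def split: if_splits)

lemma has_min_dist_nonempty: "has_min_dist \<delta> C d \<Longrightarrow> C \<noteq> {}"
  by (auto simp: has_min_dist_def)

text \<open>Needed when the minimum distance is only bounded from below, so that no explicit value
  is at hand.\<close>

lemma ex_has_min_dist:
  assumes fin: "finite C" and card: "1 < card C"
  shows "\<exists>d. has_min_dist \<delta> C (enat d)"
proof -
  let ?S = "(\<lambda>(x, y). \<delta> x y) ` {(x, y) \<in> C \<times> C. x \<noteq> y}"
  obtain x y where "x \<in> C" "y \<in> C" "x \<noteq> y"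
    using card card_le_Suc0_iff_eq[OF fin] by force
  then have "?S \<noteq> {}" by auto
  moreover have "finite ?S" by (rule finite_imageI, rule finite_subset[of _ "C \<times> C"]) (auto simp: fin)
  ultimately have "Min ?S \<in> ?S" "\<forall>s\<in>?S. Min ?S \<le> s" by auto
  then have "has_min_dist \<delta> C (enat (Min ?S))"
    using card unfolding has_min_dist_def by auto
  then show ?thesis ..
qed

lemma finite_carrier_mat: "finite (carrier_mat m n :: 'a::finite mat set)"
proof (rule finite_subset)
  show "carrier_mat m n \<subseteq> mat_of_rows n ` {xs. set xs \<subseteq> (carrier_vec n :: 'a vec set) \<and> length xs = m}"
  proof
    fix A :: "'a mat" assume A: "A \<in> carrier_mat m n"
    then show "A \<in> mat_of_rows n ` {xs. set xs \<subseteq> carrier_vec n \<and> length xs = m}"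
      using rows_carrier[of A] by (intro image_eqI[of _ _ "rows A"]) auto
  qed
  show "finite (mat_of_rows n ` {xs. set xs \<subseteq> (carrier_vec n :: 'a vec set) \<and> length xs = m})"
    by (intro finite_imageI finite_lists_length_eq) simp
qed

lemma finite_constant_dim_code:
  fixes C :: "'a::{field,finite} vec set set"
  assumes "constant_dim_code v N d k C"
  shows "finite C"
proof (rule finite_subset)
  show "C \<subseteq> Pow (carrier_vec v)" using assms by (auto simp: constant_dim_code_def is_subspace_iff)
qed simp

text \<open>Linearity enters through the zero matrix: with \<open>M = 0\<close> the first kind of
  codeword is a zero-padded copy of \<open>U\<close>.\<close>

lemma zero_in_linear_code:
  assumes "linear_rank_metric_code m n N d C"
  shows "0\<^sub>m m n \<in> C"
  using assms by (auto simp: linear_rank_metric_code_def VectorSpace.subspace_def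
      LinearCombinations.submodule_def module_mat_simps)

text \<open>The value \<open>d\<close> only bounds the distance between codewords of different kinds
  and need not be attained: three one-element codes may give two codewords at distance 2k while
  \<open>d\<close> is smaller. Hence equality is claimed when one of the other three terms is the
  minimum, and otherwise a lower bound. For \<open>d = 0\<close> a codeword can occur in both
  families, and no distance exceeds 2k, which explains the range of \<open>d\<close> in the second
  claim.\<close>

theorem theorem18:
  fixes C1 C2 C :: "'a::{field,finite} vec set set"
    and Cr :: "'a mat set"
    and v1 v2 k d N1 N2 Nr :: nat
    and d1 d2 dr :: enat
  assumes "constant_dim_code v1 N1 d1 k C1"
    and "constant_dim_code v2 N2 d2 k C2"
    and "even d"
    and "linear_rank_metric_code k (v2 - k + d div 2) Nr dr Cr"
    and "C = {tau_inv (hconcat (tau v1 U) M) | U M. U \<in> C1 \<and> M \<in> Cr} \<union>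
             {tau_inv (hconcat (0\<^sub>m k (v1 - k + d div 2)) (tau v2 W)) | W. W \<in> C2}"
  shows "(Min {d1, d2, 2 * dr} \<le> enat d \<longrightarrow>
            constant_dim_code (v1 + v2 - k + d div 2) (N1 * Nr + N2)
              (Min {d1, d2, 2 * dr, enat d}) k C) \<and>
         (0 < d \<and> d \<le> 2 * k \<longrightarrow>
            (\<exists>D. Min {d1, d2, 2 * dr, enat d} \<le> D \<and>
               constant_dim_code (v1 + v2 - k + d div 2) (N1 * Nr + N2) D k C))"
proof -
  define n where "n = v1 + v2 - k + d div 2"
  define b where "b = v2 - k + d div 2"
  define a where "a = v1 - k + d div 2"
  define F where "F = (\<lambda>(U :: 'a vec set, M). tau_inv (hconcat (tau v1 U) M))"
  define G where "G W = tau_inv (hconcat (0\<^sub>m k a) (tau v2 W))" for W :: "'a vec set"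
  define D where "D = Min {d1, d2, 2 * dr, enat d}"
  let ?\<delta> = "subspace_dist n"
  have C1: "k \<le> v1" "card C1 = N1" "has_min_dist (subspace_dist v1) C1 d1"
    "\<And>U. U \<in> C1 \<Longrightarrow> is_subspace v1 U" "\<And>U. U \<in> C1 \<Longrightarrow> sdim v1 U = k"
    using assms(1) by (auto simp: constant_dim_code_def)
  have C2: "k \<le> v2" "card C2 = N2" "has_min_dist (subspace_dist v2) C2 d2"
    "\<And>U. U \<in> C2 \<Longrightarrow> is_subspace v2 U" "\<And>U. U \<in> C2 \<Longrightarrow> sdim v2 U = k"
    using assms(2) by (auto simp: constant_dim_code_def)
  have Cr: "\<And>M. M \<in> Cr \<Longrightarrow> M \<in> carrier_mat k b" "card Cr = Nr" "has_min_dist (rank_dist k) Cr dr"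
    using assms(4) by (auto simp: linear_rank_metric_code_def rank_metric_code_def b_def)
  have zero: "0\<^sub>m k b \<in> Cr" using zero_in_linear_code[OF assms(4)] by (simp add: b_def)
  have fin: "finite C1" "finite C2" "finite Cr"
    using finite_constant_dim_code assms(1,2) finite_subset[OF _ finite_carrier_mat] Cr(1) by blast+
  have C: "C = F ` (C1 \<times> Cr) \<union> G ` C2"
    unfolding assms(5) F_def G_def a_def by auto
  note t1 = tau[OF C1(4,5)] and t2 = tau[OF C2(4,5)]
  \<comment> \<open>Since \<open>k \<le> v1\<close> and \<open>k \<le> v2\<close>, no subtraction
    truncates and both block layouts have the same total length.\<close>
  have nb: "v1 + b = n" and na: "a + v2 = n"
    using C1(1) C2(1) by (auto simp: n_def a_def b_def)
  have Z: "0\<^sub>m k a \<in> carrier_mat k a" by simp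
  have F_sub: "is_subspace n (F (U, M))" "sdim n (F (U, M)) = k" if "U \<in> C1" "M \<in> Cr" for U M
    using hconcat_subspace[OF t1(1) Cr(1) disjI1[OF t1(3)]] that by (simp_all add: F_def nb)
  have G_sub: "is_subspace n (G W)" "sdim n (G W) = k" if "W \<in> C2" for W
    using hconcat_subspace[OF Z t2(1) disjI2[OF t2(3)]] that by (simp_all add: G_def na)
  have sub: "is_subspace n X" "sdim n X = k" if "X \<in> C" for X
    using that F_sub G_sub unfolding C by auto
  have FF1: "subspace_dist v1 U U' \<le> ?\<delta> (F (U, M)) (F (U', M'))"
    if "U \<in> C1" "U' \<in> C1" "M \<in> Cr" "M' \<in> Cr" for U U' M M'
    using hconcat_dist_ge[OF t1(1,3) t1(1,3) Cr(1) Cr(1)] that by (simp add: F_def nb t1(2))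
  have FF0: "?\<delta> (F (U, 0\<^sub>m k b)) (F (U', 0\<^sub>m k b)) = subspace_dist v1 U U'" if "U \<in> C1" "U' \<in> C1" for U U'
    using hconcat_dist_zero_right[OF t1(1,3) t1(1,3), where b = b] that by (simp add: F_def nb t1(2))
  have FF2: "?\<delta> (F (U, M)) (F (U, M')) = 2 * rank_dist k M M'" if "U \<in> C1" "M \<in> Cr" "M' \<in> Cr" for U M M'
    using hconcat_dist_same_left[OF t1(1,3) Cr(1) Cr(1)] that by (simp add: F_def nb)
  have GG: "?\<delta> (G W) (G W') = subspace_dist v2 W W'" if "W \<in> C2" "W' \<in> C2" for W W'
    using hconcat_dist_zero_left[OF t2(1,3) t2(1,3), where a = a] that by (simp add: G_def na t2(2))
  have FG: "min d (2 * k) \<le> ?\<delta> (F (U, M)) (G W)" if "U \<in> C1" "M \<in> Cr" "W \<in> C2" for U M W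
  proof -
    \<comment> \<open>The overlap parameter is \<open>e = k - d div 2\<close>, for which
      \<open>v1 \<le> a + e\<close> and \<open>e \<le> v1\<close>.\<close>
    have "2 * (k - (k - d div 2)) \<le> ?\<delta> (F (U, M)) (G W)"
      unfolding F_def G_def prod.case
      by (rule hconcat_dist_overlap[OF t1(1,3) Cr(1) t2(1,3) nb na]) (use that C1(1) in \<open>auto simp: a_def\<close>)
    \<comment> \<open>\<open>k - d div 2\<close> truncates to \<open>0\<close> if \<open>d > 2 * k\<close>\<close>
    moreover have "2 * (k - (k - d div 2)) = min d (2 * k)" using \<open>even d\<close> by (auto elim!: evenE)
    ultimately show ?thesis by simp
  qed
  have two: "2 * enat r = enat (2 * r)" for r by (simp add: numeral_eq_enat)
  have D_le: "D \<le> d1" "D \<le> d2" "D \<le> 2 * dr" "D \<le> enat d"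
    unfolding D_def by (rule Min_le; simp)+
  \<comment> \<open>Positivity is proved along with the bound: a positive distance separates
    codewords with different parameters and so yields the cardinality.\<close>
  have F_dist: "D \<le> enat (?\<delta> (F p) (F p'))" "0 < ?\<delta> (F p) (F p')"
    if pp: "p \<in> C1 \<times> Cr" "p' \<in> C1 \<times> Cr" "p \<noteq> p'" for p p'
  proof -
    obtain U M U' M' where p: "p = (U, M)" "p' = (U', M')" by fastforce
    have in_codes: "U \<in> C1" "U' \<in> C1" "M \<in> Cr" "M' \<in> Cr" using pp p by auto
    have "D \<le> enat (?\<delta> (F p) (F p')) \<and> 0 < ?\<delta> (F p) (F p')"
    proof (cases "U = U'")
      case False
      have "D \<le> enat (subspace_dist v1 U U')"
        using D_le(1) has_min_dist_le[OF C1(3) in_codes(1,2) False] by (rule order_trans)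
      moreover have "0 < subspace_dist v1 U U'"
        using False in_codes C1(4,5) by (intro subspace_dist_pos[where k = k]) auto
      moreover note FF1[OF in_codes]
      ultimately show ?thesis unfolding p by (meson enat_ord_simps(1) less_le_trans order_trans)
    next
      case True
      then have ne: "M \<noteq> M'" using pp p by auto
      have "2 * dr \<le> 2 * enat (rank_dist k M M')"
        using has_min_dist_le[OF Cr(3) in_codes(3,4) ne] by (intro mult_left_mono) auto
      then have "D \<le> enat (2 * rank_dist k M M')" using D_le(3) two by (metis order_trans)
      moreover have "0 < rank_dist k M M'" using ne Cr(1) in_codes by (intro rank_dist_pos) auto
      ultimately show ?thesis using FF2[of U M M'] in_codes True unfolding p by simp
    qed
    then show "D \<le> enat (?\<delta> (F p) (F p'))" "0 < ?\<delta> (F p) (F p')" by auto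
  qed
  have G_dist: "D \<le> enat (?\<delta> (G W) (G W'))" "0 < ?\<delta> (G W) (G W')"
    if "W \<in> C2" "W' \<in> C2" "W \<noteq> W'" for W W'
  proof -
    show "D \<le> enat (?\<delta> (G W) (G W'))"
      using D_le(2) has_min_dist_le[OF C2(3) that] GG that by (metis order_trans)
    show "0 < ?\<delta> (G W) (G W')"
      unfolding GG[OF that(1,2)] using that C2(4,5) by (intro subspace_dist_pos[where k = k]) auto
  qed
  \<comment> \<open>Both claims rest on this. A positive cross distance makes the two families
    disjoint, and the second assumption bounds mixed pairs.\<close>
  have main: "card C = N1 * Nr + N2" "\<And>X Y. X \<in> C \<Longrightarrow> Y \<in> C \<Longrightarrow> X \<noteq> Y \<Longrightarrow> D \<le> enat (?\<delta> X Y)"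
    if pos: "0 < min d (2 * k)" and D: "D \<le> enat (min d (2 * k))"
  proof -
    have FG': "D \<le> enat (?\<delta> (F p) (G W))" "0 < ?\<delta> (F p) (G W)" if "p \<in> C1 \<times> Cr" "W \<in> C2" for p W
      using FG[of "fst p" "snd p" W] that pos order_trans[OF D] by auto
    have "inj_on F (C1 \<times> Cr)" using F_dist(2) by (metis inj_onI less_irrefl subspace_dist_self)
    moreover have "inj_on G C2" using G_dist(2) by (metis inj_onI less_irrefl subspace_dist_self)
    moreover have "F ` (C1 \<times> Cr) \<inter> G ` C2 = {}"
    proof (rule ccontr)
      assume "F ` (C1 \<times> Cr) \<inter> G ` C2 \<noteq> {}"
      then obtain p W where "p \<in> C1 \<times> Cr" "W \<in> C2" "F p = G W" by blast
      then show False using FG'(2) by (metis less_irrefl subspace_dist_self)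
    qed
    ultimately show "card C = N1 * Nr + N2"
      unfolding C using fin C1(2) C2(2) Cr(2)
      by (simp add: card_Un_disjoint card_image card_cartesian_product)
    fix X Y assume "X \<in> C" "Y \<in> C" "X \<noteq> Y"
    then consider p p' where "p \<in> C1 \<times> Cr" "p' \<in> C1 \<times> Cr" "X = F p" "Y = F p'" "p \<noteq> p'"
      | p W where "p \<in> C1 \<times> Cr" "W \<in> C2" "X = F p" "Y = G W"
      | p W where "p \<in> C1 \<times> Cr" "W \<in> C2" "Y = F p" "X = G W"
      | W W' where "W \<in> C2" "W' \<in> C2" "X = G W" "Y = G W'" "W \<noteq> W'"
      unfolding C by blast
    then show "D \<le> enat (?\<delta> X Y)"
    proof cases
      case 1
      then show ?thesis using F_dist(1) by simp
    next
      case 2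
      then show ?thesis using FG'(1) by simp
    next
      case 3
      then show ?thesis using FG'(1) subspace_dist_commute by metis
    next
      case 4
      then show ?thesis using G_dist(1) by simp
    qed
  qed
  have kn: "k \<le> n" using C1(1) C2(1) by (simp add: n_def)
  have finC: "finite C" unfolding C using fin by simp
  \<comment> \<open>\<open>has_min_dist\<close> excludes empty codes. Thus \<open>C\<close> will
    have at least two words, and the value infinity for one-element codes does not arise.\<close>
  have "0 < N1" "0 < N2" "0 < Nr"
    using C1(2) C2(2) Cr(2) fin has_min_dist_nonempty C1(3) C2(3) Cr(3) by (metis card_gt_0_iff)+
  then have two_words: "1 < N1 * Nr + N2"
    using mult_pos_pos[of N1 Nr] by linarith
  have first: "constant_dim_code n (N1 * Nr + N2) D k C" if m: "Min {d1, d2, 2 * dr} \<le> enat d"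
  proof -
    have "D = min (enat d) (Min {d1, d2, 2 * dr})"
      unfolding D_def by (simp add: min.left_commute min.commute)
    with m have Dm: "D = Min {d1, d2, 2 * dr}" by (simp only: min_absorb2)
    then have "D \<in> {d1, d2, 2 * dr}" by (metis Min_in finite.emptyI finite_insert insert_not_empty)
    moreover obtain D' where D': "D = enat D'" using m Dm by (metis enat_ile)
    ultimately consider "d1 = enat D'" | "d2 = enat D'" | "2 * dr = enat D'" by auto
    then have "\<exists>X\<in>C. \<exists>Y\<in>C. D' = ?\<delta> X Y \<and> 0 < ?\<delta> X Y"
    proof cases
      case 1
      then obtain U U' where U: "U \<in> C1" "U' \<in> C1" "U \<noteq> U'" "D' = subspace_dist v1 U U'"
        using C1(3) has_min_dist_attained by metis
      show ?thesis
        \<comment> \<open>The zero matrix belongs to \<open>Cr\<close>, and zero padding preserves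
          the distance of a closest pair in \<open>C1\<close>.\<close>
        by (rule bexI[of _ "F (U, 0\<^sub>m k b)"], rule bexI[of _ "F (U', 0\<^sub>m k b)"])
          (use U FF0[OF U(1,2)] F_dist(2)[of "(U, 0\<^sub>m k b)" "(U', 0\<^sub>m k b)"] zero in \<open>auto simp: C\<close>)
    next
      case 2
      then obtain W W' where W: "W \<in> C2" "W' \<in> C2" "W \<noteq> W'" "D' = subspace_dist v2 W W'"
        using C2(3) has_min_dist_attained by metis
      show ?thesis
        by (rule bexI[of _ "G W"], rule bexI[of _ "G W'"])
          (use W GG[OF W(1,2)] G_dist(2)[OF W(1,2,3)] in \<open>auto simp: C\<close>)
    next
      case 3
      then obtain r where r: "dr = enat r" by (cases dr) (auto simp: numeral_eq_enat)
      then obtain M M' where M: "M \<in> Cr" "M' \<in> Cr" "M \<noteq> M'" "r = rank_dist k M M'"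
        using Cr(3) has_min_dist_attained by metis
      obtain U where U: "U \<in> C1" using has_min_dist_nonempty[OF C1(3)] by auto
      show ?thesis
        by (rule bexI[of _ "F (U, M)"], rule bexI[of _ "F (U, M')"])
          (use 3 r M U FF2[OF U M(1,2)] F_dist(2)[of "(U, M)" "(U, M')"] two in \<open>auto simp: C\<close>)
    qed
    then obtain X Y where XY: "X \<in> C" "Y \<in> C" "D' = ?\<delta> X Y" "0 < ?\<delta> X Y" by blast
    then have ne: "X \<noteq> Y" using subspace_dist_self by (metis less_irrefl)
    \<comment> \<open>\<open>D'\<close> is a distance between two codewords, so it is positive and
      at most 2k; together with \<open>D' \<le> d\<close> this supplies the assumptions of
      \<open>main\<close>.\<close>
    have "D' \<le> 2 * k" using XY(3) subspace_dist_le[OF sub(2)[OF XY(1)] sub(2)[OF XY(2)]] by simp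
    moreover have "D' \<le> d" using D_le(4) D' by simp
    ultimately have p: "0 < min d (2 * k)" "D \<le> enat (min d (2 * k))" using XY D' by auto
    note main = main[OF p]
    have "\<exists>X\<in>C. \<exists>Y\<in>C. X \<noteq> Y \<and> D = enat (?\<delta> X Y)"
      using XY(1-3) ne D' by blast
    then have "has_min_dist ?\<delta> C D"
      unfolding has_min_dist_def using main two_words by simp
    then show ?thesis using main(1) sub kn by (auto simp: constant_dim_code_def)
  qed
  have second: "\<exists>E\<ge>D. constant_dim_code n (N1 * Nr + N2) E k C" if d: "0 < d" "d \<le> 2 * k"
  proof -
    have p: "0 < min d (2 * k)" "D \<le> enat (min d (2 * k))" using d D_le(4) by (auto simp: min_def)
    note main = main[OF p]
    obtain E where E: "has_min_dist ?\<delta> C (enat E)"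
      using ex_has_min_dist[OF finC] main(1) two_words by auto
    then obtain X Y where "X \<in> C" "Y \<in> C" "X \<noteq> Y" "E = ?\<delta> X Y" by (rule has_min_dist_attained)
    then have "D \<le> enat E" using main(2) by simp
    then show ?thesis using E main(1) sub kn by (auto simp: constant_dim_code_def)
  qed
  show ?thesis
    using first second unfolding D_def n_def by blast
qed

end
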